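(* There exist countably (infinitely) many real analytic time-like surfaces in $\mathbb{L}^3$ (germs of immersions $h:U\to\mathbb{L}^3$ defined on neighborhoods $U$ of the origin $o\in\mathbb{R}^2$) with non-positive Gaussian curvature for which $o$ is an isolated umbilic and which admit a pair of real analytic curvature line flows on $U\setminus\{o\}$ whose indices at $o$ are $1$ and $-1$, respectively.
   Context: $\mathbb{L}^3$ is the Lorentz-Minkowski 3-space, i.e. $\mathbb{R}^3$ with the inner product $x_1y_1+x_2y_2-x_3y_3$ (signature $(++-)$). A time-like surface is an immersion $h:U\to\mathbb{L}^3$ whose induced metric is Lorentzian. With $\nu$ a unit normal field ($\nu\cdot\nu=1$), the shape operator $A_h$ is defined by $d\nu=-dh\circ A_h$. An umbilic is a point where $A_h$ is a scalar multiple of the identity. The Gaussian curvature of $h$ is that of the induced Lorentzian metric, which equals $\det A_h$; its sign is opposite to that of the Gaussian curvature of the same surface regarded in Euclidean 3-space. A principal direction is a (real) eigen-direction of $A_h$. A real analytic curvature line flow on $U\setminus\{o\}$ is the flow (foliation) generated by a real analytic field of principal directions (1-dimensional tangent subspaces) on $U\setminus\{o\}$. Its index at $o$ is the total variation of the angle of the direction along a small counterclockwise circle around $o$, divided by $2\pi$, an element of $\frac12\mathbb{Z}$. *)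

theory Defs
  imports "HOL-Analysis.Analysis"
begin

section \<open>Real analyticity in two variables\<close>

text \<open>Summation over the unordered index set of pairs amounts to absolute convergence of the
  double power series, since the target spaces used below are finite-dimensional.\<close>

definition real_analytic_at :: "(real^2 \<Rightarrow> 'b::real_normed_vector) \<Rightarrow> real^2 \<Rightarrow> bool" where
  "real_analytic_at f p \<longleftrightarrow>
     (\<exists>(a :: nat \<Rightarrow> nat \<Rightarrow> 'b) r. r > 0 \<and>
        (\<forall>x \<in> ball p r.
           ((\<lambda>(i, j). ((x$1 - p$1) ^ i * (x$2 - p$2) ^ j) *\<^sub>R a i j) has_sum f x) UNIV))"

definition real_analytic_on :: "(real^2 \<Rightarrow> 'b::real_normed_vector) \<Rightarrow> (real^2) set \<Rightarrow> bool" where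
  "real_analytic_on f S \<longleftrightarrow> (\<forall>p \<in> S. real_analytic_at f p)"


section \<open>Time-like surfaces in Lorentz-Minkowski 3-space\<close>

definition lorentz :: "real^3 \<Rightarrow> real^3 \<Rightarrow> real" where
  "lorentz x y = x$1 * y$1 + x$2 * y$2 - x$3 * y$3"

definition induced_metric :: "(real^2 \<Rightarrow> real^3) \<Rightarrow> real^2 \<Rightarrow> real^2 \<Rightarrow> real^2 \<Rightarrow> real" where
  "induced_metric h p v w =
     lorentz (frechet_derivative h (at p) v) (frechet_derivative h (at p) w)"

definition lorentzian_form :: "(real^2 \<Rightarrow> real^2 \<Rightarrow> real) \<Rightarrow> bool" where
  "lorentzian_form g \<longleftrightarrow> (\<exists>e1 e2. g e1 e1 = 1 \<and> g e2 e2 = - 1 \<and> g e1 e2 = 0)"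

definition real_analytic_timelike_surface ::
    "(real^2) set \<Rightarrow> (real^2 \<Rightarrow> real^3) \<Rightarrow> bool" where
  "real_analytic_timelike_surface U h \<longleftrightarrow>
     open U \<and> real_analytic_on h U \<and>
     (\<forall>p \<in> U. inj (frechet_derivative h (at p)) \<and> lorentzian_form (induced_metric h p))"


section \<open>Gaussian curvature of the induced metric\<close>

definition partial :: "2 \<Rightarrow> (real^2 \<Rightarrow> real) \<Rightarrow> real^2 \<Rightarrow> real" where
  "partial i f p = frechet_derivative f (at p) (axis i 1)"

definition metric_matrix :: "(real^2 \<Rightarrow> real^3) \<Rightarrow> real^2 \<Rightarrow> real^2^2" where
  "metric_matrix h p = (\<chi> i j. induced_metric h p (axis i 1) (axis j 1))"

text \<open>\<open>christoffel h k i j\<close> is the symbol with upper index \<open>k\<close> and lower indices \<open>i, j\<close>.\<close>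

definition christoffel :: "(real^2 \<Rightarrow> real^3) \<Rightarrow> 2 \<Rightarrow> 2 \<Rightarrow> 2 \<Rightarrow> real^2 \<Rightarrow> real" where
  "christoffel h k i j p =
     (\<Sum>l\<in>UNIV. matrix_inv (metric_matrix h p) $ k $ l *
        (partial i (\<lambda>q. metric_matrix h q $ j $ l) p
         + partial j (\<lambda>q. metric_matrix h q $ i $ l) p
         - partial l (\<lambda>q. metric_matrix h q $ i $ j) p)) / 2"

text \<open>\<open>riemann h l k i j\<close> is the \<open>l\<close>-th component of \<open>R(\<partial>\<^sub>i, \<partial>\<^sub>j) \<partial>\<^sub>k\<close>, where
  \<open>R(X, Y) = [\<nabla>\<^sub>X, \<nabla>\<^sub>Y] - \<nabla>\<^bsub>[X, Y]\<^esub>\<close>.\<close>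

definition riemann :: "(real^2 \<Rightarrow> real^3) \<Rightarrow> 2 \<Rightarrow> 2 \<Rightarrow> 2 \<Rightarrow> 2 \<Rightarrow> real^2 \<Rightarrow> real" where
  "riemann h l k i j p =
     partial i (christoffel h l j k) p - partial j (christoffel h l i k) p
     + (\<Sum>m\<in>UNIV. christoffel h l i m p * christoffel h m j k p
                  - christoffel h l j m p * christoffel h m i k p)"

text \<open>The curvature \<open>\<langle>R(X, Y) Y, X\<rangle> / (\<langle>X, X\<rangle> \<langle>Y, Y\<rangle> - \<langle>X, Y\<rangle>\<^sup>2)\<close> for \<open>X = \<partial>\<^sub>1\<close>, \<open>Y = \<partial>\<^sub>2\<close>; with
  this sign the de Sitter plane \<open>{x. lorentz x x = 1}\<close> has curvature \<open>1\<close>.\<close>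

definition gaussian_curvature :: "(real^2 \<Rightarrow> real^3) \<Rightarrow> real^2 \<Rightarrow> real" where
  "gaussian_curvature h p =
     (\<Sum>l\<in>UNIV. metric_matrix h p $ 1 $ l * riemann h l 2 1 2 p) / det (metric_matrix h p)"


section \<open>Shape operator, umbilics and curvature line flows\<close>

definition unit_normal_field ::
    "(real^2) set \<Rightarrow> (real^2 \<Rightarrow> real^3) \<Rightarrow> (real^2 \<Rightarrow> real^3) \<Rightarrow> bool" where
  "unit_normal_field U h \<nu> \<longleftrightarrow>
     (\<forall>p \<in> U. \<nu> differentiable (at p) \<and> lorentz (\<nu> p) (\<nu> p) = 1 \<and>
        (\<forall>v. lorentz (\<nu> p) (frechet_derivative h (at p) v) = 0))"

text \<open>Since \<open>dh\<close> is injective and \<open>d\<nu>\<close> is tangential, the operator below exists and is unique.\<close>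

definition shape_operator ::
    "(real^2 \<Rightarrow> real^3) \<Rightarrow> (real^2 \<Rightarrow> real^3) \<Rightarrow> real^2 \<Rightarrow> real^2 \<Rightarrow> real^2" where
  "shape_operator h \<nu> p =
     (THE A. linear A \<and>
        (\<forall>v. frechet_derivative \<nu> (at p) v = - frechet_derivative h (at p) (A v)))"

definition umbilic :: "(real^2 \<Rightarrow> real^3) \<Rightarrow> (real^2 \<Rightarrow> real^3) \<Rightarrow> real^2 \<Rightarrow> bool" where
  "umbilic h \<nu> p \<longleftrightarrow> (\<exists>c. \<forall>v. shape_operator h \<nu> p v = c *\<^sub>R v)"

definition isolated_umbilic :: "(real^2 \<Rightarrow> real^3) \<Rightarrow> (real^2 \<Rightarrow> real^3) \<Rightarrow> real^2 \<Rightarrow> bool" where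
  "isolated_umbilic h \<nu> p \<longleftrightarrow> umbilic h \<nu> p \<and> (\<forall>\<^sub>F q in at p. \<not> umbilic h \<nu> q)"

definition principal_direction ::
    "(real^2 \<Rightarrow> real^3) \<Rightarrow> (real^2 \<Rightarrow> real^3) \<Rightarrow> real^2 \<Rightarrow> (real^2) set \<Rightarrow> bool" where
  "principal_direction h \<nu> p l \<longleftrightarrow>
     (\<exists>v c. v \<noteq> 0 \<and> l = span {v} \<and> shape_operator h \<nu> p v = c *\<^sub>R v)"

text \<open>A direction field assigns to each point a 1-dimensional subspace of \<open>\<real>\<^sup>2\<close>. It need not be
  globally orientable, hence the local generating vector fields.\<close>

definition real_analytic_direction_field ::
    "(real^2) set \<Rightarrow> (real^2 \<Rightarrow> (real^2) set) \<Rightarrow> bool" where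
  "real_analytic_direction_field S d \<longleftrightarrow>
     (\<forall>p \<in> S. \<exists>X. real_analytic_at X p \<and>
        (\<forall>\<^sub>F q in nhds p. (X q :: real^2) \<noteq> 0 \<and> d q = span {X q}))"

text \<open>The flow (foliation) is represented by the direction field generating it.\<close>

definition real_analytic_curvature_line_flow ::
    "(real^2) set \<Rightarrow> (real^2 \<Rightarrow> real^3) \<Rightarrow> (real^2 \<Rightarrow> real^3) \<Rightarrow> (real^2 \<Rightarrow> (real^2) set) \<Rightarrow> bool" where
  "real_analytic_curvature_line_flow S h \<nu> d \<longleftrightarrow>
     real_analytic_direction_field S d \<and> (\<forall>p \<in> S. principal_direction h \<nu> p (d p))"

text \<open>\<open>\<theta>\<close> is a continuous choice of the angle of the direction along the counterclockwise circle of
  radius \<open>r\<close> around \<open>p\<close>; it is determined up to a constant multiple of \<open>pi\<close>.\<close>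

definition has_index :: "(real^2 \<Rightarrow> (real^2) set) \<Rightarrow> real^2 \<Rightarrow> real \<Rightarrow> bool" where
  "has_index d p k \<longleftrightarrow>
     (\<exists>\<epsilon>>0. \<forall>r. 0 < r \<and> r < \<epsilon> \<longrightarrow>
        (\<exists>\<theta> :: real \<Rightarrow> real. continuous_on {0..2*pi} \<theta> \<and>
           (\<forall>t \<in> {0..2*pi}.
              d (p + r *\<^sub>R vector [cos t, sin t]) = span {vector [cos (\<theta> t), sin (\<theta> t)]}) \<and>
           k = (\<theta> (2*pi) - \<theta> 0) / (2*pi)))"


section \<open>Congruence of surface germs\<close>

definition lorentz_isometry :: "(real^3 \<Rightarrow> real^3) \<Rightarrow> bool" where
  "lorentz_isometry T \<longleftrightarrow>
     (\<exists>L a. linear L \<and> (\<forall>x y. lorentz (L x) (L y) = lorentz x y) \<and> T = (\<lambda>x. L x + a))"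

text \<open>The germs at the origin of two immersions represent the same surface germ up to an isometry of
  the ambient space. By the inverse function theorem \<open>\<phi>\<close> is a local analytic diffeomorphism.\<close>

definition congruent_germs :: "(real^2 \<Rightarrow> real^3) \<Rightarrow> (real^2 \<Rightarrow> real^3) \<Rightarrow> bool" where
  "congruent_germs h1 h2 \<longleftrightarrow>
     (\<exists>T \<phi>. lorentz_isometry T \<and>
        \<phi> 0 = (0 :: real^2) \<and> real_analytic_at \<phi> 0 \<and> inj (frechet_derivative \<phi> (at 0)) \<and>
        (\<forall>\<^sub>F p in nhds 0. h2 (\<phi> p) = T (h1 p)))"

end

theory Submission
  imports Defs
begin

text \<open>The examples are time-like minimal surfaces \<open>h(u, v) = \<alpha>(u) + \<beta>(v)\<close> with \<open>\<alpha>\<close>, \<open>\<beta>\<close> null curves.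
  In the null coordinates \<open>u, v\<close> the metric is \<open>2 F du dv\<close> and the second fundamental form is
  \<open>P(u) du\<^sup>2 + Q(v) dv\<^sup>2\<close>, so that the curvature is \<open>- P Q / F\<^sup>2\<close> and the principal directions \<open>(x, y)\<close>
  satisfy \<open>P x\<^sup>2 = Q y\<^sup>2\<close>. Up to a constant factor we take \<open>P = u\<^bsup>2k\<^esup>\<close> and \<open>Q = v\<^bsup>2k\<^esup>\<close> with \<open>k\<close> odd: the
  directions are then \<open>(v\<^sup>k, - u\<^sup>k)\<close> and \<open>(v\<^sup>k, u\<^sup>k)\<close>, which have the indices
  of \<open>(v, - u)\<close> and \<open>(v, u)\<close>, that is 1 and -1. Congruent surfaces have the same order of contact
  with their tangent planes at the umbilic, and this order is \<open>2k + 2\<close>.\<close>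

section \<open>Real analytic functions\<close>

lemma real_analytic_at_add:
  assumes "real_analytic_at f p" "real_analytic_at g p"
  shows "real_analytic_at (\<lambda>x. f x + g x) p"
proof -
  obtain a r where a: "r > 0" "\<And>x. x \<in> ball p r \<Longrightarrow>
      ((\<lambda>(i, j). ((x$1 - p$1) ^ i * (x$2 - p$2) ^ j) *\<^sub>R a i j) has_sum f x) UNIV"
    using assms(1) unfolding real_analytic_at_def by blast
  obtain b s where b: "s > 0" "\<And>x. x \<in> ball p s \<Longrightarrow>
      ((\<lambda>(i, j). ((x$1 - p$1) ^ i * (x$2 - p$2) ^ j) *\<^sub>R b i j) has_sum g x) UNIV"
    using assms(2) unfolding real_analytic_at_def by blast
  have "((\<lambda>(i, j). ((x$1 - p$1) ^ i * (x$2 - p$2) ^ j) *\<^sub>R (a i j + b i j)) has_sum f x + g x) UNIV"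
    if "x \<in> ball p (min r s)" for x
    using has_sum_add[OF a(2) b(2), of x] that
    by (simp add: case_prod_unfold scaleR_add_right)
  then show ?thesis
    unfolding real_analytic_at_def using a(1) b(1)
    by (intro exI[of _ "\<lambda>i j. a i j + b i j"] exI[of _ "min r s"]) auto
qed

text \<open>The binomial expansion of \<open>x$1 = (x$1 - p$1) + p$1\<close> leaves finitely many
  nonzero coefficients. The surfaces and direction fields below are sums of such monomials and of
  their twins in \<open>x$2\<close>.\<close>

lemma real_analytic_at_monomial_1:
  "real_analytic_at (\<lambda>x::real^2. x$1 ^ N *\<^sub>R c) p"
proof -
  define a where "a i j = (if j = 0 \<and> i \<le> N then (of_nat (N choose i) * p$1 ^ (N - i)) *\<^sub>R c else 0)"
    for i j :: nat
  have "((\<lambda>(i, j). ((x$1 - p$1) ^ i * (x$2 - p$2) ^ j) *\<^sub>R a i j) has_sum x$1 ^ N *\<^sub>R c) UNIV" for x :: "real^2"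
  proof -
    have "x$1 ^ N *\<^sub>R c = (\<Sum>i\<le>N. of_nat (N choose i) * (x$1 - p$1) ^ i * p$1 ^ (N - i)) *\<^sub>R c"
      using binomial_ring[of "x$1 - p$1" "p$1" N] by simp
    also have "\<dots> = (\<Sum>i\<le>N. (x$1 - p$1) ^ i *\<^sub>R a i 0)"
      unfolding scaleR_sum_left by (intro sum.cong) (auto simp: a_def mult_ac)
    also have "\<dots> = (\<Sum>(i, j)\<in>{..N} \<times> {0}. ((x$1 - p$1) ^ i * (x$2 - p$2) ^ j) *\<^sub>R a i j)"
      by (simp add: sum.cartesian_product[symmetric])
    finally have *: "((\<lambda>(i, j). ((x$1 - p$1) ^ i * (x$2 - p$2) ^ j) *\<^sub>R a i j) has_sum x$1 ^ N *\<^sub>R c)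
        ({..N} \<times> {0})"
      by (simp add: has_sum_finiteI)
    show ?thesis
      by (rule has_sum_cong_neutral[THEN iffD1, OF _ _ _ *]) (auto simp: a_def split: if_splits)
  qed
  then show ?thesis
    unfolding real_analytic_at_def by (intro exI[of _ a] exI[of _ 1]) auto
qed

lemma real_analytic_at_monomial_2:
  "real_analytic_at (\<lambda>x::real^2. x$2 ^ N *\<^sub>R c) p"
proof -
  define a where "a i j = (if i = 0 \<and> j \<le> N then (of_nat (N choose j) * p$2 ^ (N - j)) *\<^sub>R c else 0)"
    for i j :: nat
  have "((\<lambda>(i, j). ((x$1 - p$1) ^ i * (x$2 - p$2) ^ j) *\<^sub>R a i j) has_sum x$2 ^ N *\<^sub>R c) UNIV" for x :: "real^2"
  proof -
    have "x$2 ^ N *\<^sub>R c = (\<Sum>i\<le>N. of_nat (N choose i) * (x$2 - p$2) ^ i * p$2 ^ (N - i)) *\<^sub>R c"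
      using binomial_ring[of "x$2 - p$2" "p$2" N] by simp
    also have "\<dots> = (\<Sum>i\<le>N. (x$2 - p$2) ^ i *\<^sub>R a 0 i)"
      unfolding scaleR_sum_left by (intro sum.cong) (auto simp: a_def mult_ac)
    also have "\<dots> = (\<Sum>(i, j)\<in>{0} \<times> {..N}. ((x$1 - p$1) ^ i * (x$2 - p$2) ^ j) *\<^sub>R a i j)"
      by (simp add: sum.cartesian_product[symmetric])
    finally have *: "((\<lambda>(i, j). ((x$1 - p$1) ^ i * (x$2 - p$2) ^ j) *\<^sub>R a i j) has_sum x$2 ^ N *\<^sub>R c)
        ({0} \<times> {..N})"
      by (simp add: has_sum_finiteI)
    show ?thesis
      by (rule has_sum_cong_neutral[THEN iffD1, OF _ _ _ *]) (auto simp: a_def split: if_splits)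
  qed
  then show ?thesis
    unfolding real_analytic_at_def by (intro exI[of _ a] exI[of _ 1]) auto
qed

section \<open>Differentiability of real analytic functions\<close>

lemma has_derivative_of_quadratic_remainder:
  fixes f :: "'a::real_normed_vector \<Rightarrow> 'b::real_normed_vector"
  assumes "bounded_linear L" and "r > 0"
    and rem: "\<And>x. x \<in> ball p r \<Longrightarrow> norm (f x - f p - L (x - p)) \<le> C * norm (x - p) ^ 2"
  shows "(f has_derivative L) (at p)"
  unfolding has_derivative_at_alt
proof (intro conjI allI impI)
  fix e :: real assume e: "e > 0"
  \<comment> \<open>Within this radius \<open>(\<bar>C\<bar> + 1) * norm (y - p) \<le> e\<close>, so
    the quadratic bound becomes a little-o bound.\<close>
  define d where "d = min r (e / (\<bar>C\<bar> + 1))"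
  have "norm (f y - f p - L (y - p)) \<le> e * norm (y - p)" if y: "norm (y - p) < d" for y
  proof -
    have "norm (f y - f p - L (y - p)) \<le> C * norm (y - p) ^ 2"
      using y by (intro rem) (auto simp: d_def dist_norm norm_minus_commute)
    also have "\<dots> \<le> ((\<bar>C\<bar> + 1) * norm (y - p)) * norm (y - p)"
      unfolding power2_eq_square mult.assoc[symmetric] by (intro mult_right_mono) auto
    also have "\<dots> \<le> e * norm (y - p)"
      using y by (intro mult_right_mono) (auto simp: d_def field_simps)
    finally show ?thesis .
  qed
  moreover have "d > 0" using e assms(2) by (simp add: d_def add_nonneg_pos)
  ultimately show "\<exists>d>0. \<forall>y. norm (y - p) < d \<longrightarrow> norm (f y - f p - L (y - p)) \<le> e * norm (y - p)"
    by blast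
qed (fact assms)

text \<open>Absolute convergence at one point off both axes through \<open>p\<close> controls the
  series nearby: with coordinates at most \<open>n < t\<close>, each term of degree at least two is
  at most \<open>(n / t)\<^sup>2\<close> times the corresponding term there. The remainder after the
  linear part is thus quadratic. The result serves the parameter change in
  \<open>congruent_germs\<close>, which is only assumed analytic.\<close>

lemma real_analytic_at_imp_differentiable_real:
  fixes f :: "real^2 \<Rightarrow> real"
  assumes "real_analytic_at f p"
  shows "f differentiable (at p)"
proof -
  obtain a r where r: "r > 0" and a: "\<And>x. x \<in> ball p r \<Longrightarrow>
      ((\<lambda>(i, j). ((x$1 - p$1) ^ i * (x$2 - p$2) ^ j) *\<^sub>R a i j) has_sum f x) UNIV"
    using assms unfolding real_analytic_at_def by blast
  \<comment> \<open>The point with both offsets equal to \<open>t\<close> lies at distance at most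
    \<open>2 * t < r\<close> from \<open>p\<close>.\<close>
  define t where "t = r / 3"
  have t: "t > 0" using r by (simp add: t_def)
  define q :: "real^2" where "q = p + vector [t, t]"
  have "norm (q - p) \<le> \<bar>t\<bar> + \<bar>t\<bar>"
    using norm_le_l1_cart[of "q - p"] by (simp add: sum_2 q_def)
  then have "q \<in> ball p r" using t by (simp add: t_def dist_norm norm_minus_commute)
  from a[OF this] have "(\<lambda>(i, j). t ^ (i + j) * a i j) summable_on UNIV"
    by (auto simp: q_def power_add summable_on_def)
  then have abs: "(\<lambda>(i, j). t ^ (i + j) * \<bar>a i j\<bar>) summable_on UNIV"
    unfolding summable_on_iff_abs_summable_on_real[of "case_prod _"]
    using t by (simp add: case_prod_unfold abs_mult)
  define M where "M = infsum (\<lambda>(i, j). t ^ (i + j) * \<bar>a i j\<bar>) UNIV"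
  define L where "L v = v$1 * a 1 0 + v$2 * a 0 1" for v :: "real^2"
  define low :: "(nat \<times> nat) set" where "low = {(0, 0), (1, 0), (0, 1)}"
  \<comment> \<open>At the centre only the constant term survives, with the convention that 0 to the
    power 0 is 1.\<close>
  have at_p: "f p = a 0 0"
  proof -
    have "((\<lambda>(i, j). ((p$1 - p$1) ^ i * (p$2 - p$2) ^ j) *\<^sub>R a i j) has_sum a 0 0) {(0, 0)}"
      by (rule has_sum_finiteI) auto
    then have "((\<lambda>(i, j). ((p$1 - p$1) ^ i * (p$2 - p$2) ^ j) *\<^sub>R a i j) has_sum a 0 0) UNIV"
      by (rule has_sum_cong_neutral[THEN iffD1, rotated -1]) auto
    with a[of p] r show ?thesis by (auto dest: has_sum_unique)
  qed
  have "norm (f x - f p - L (x - p)) \<le> M / t\<^sup>2 * norm (x - p) ^ 2" if x: "x \<in> ball p t" for x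
  proof -
    define w where "w = (\<lambda>(i, j). ((x$1 - p$1) ^ i * (x$2 - p$2) ^ j) *\<^sub>R a i j)"
    define n where "n = norm (x - p)"
    have n: "n < t" "n \<ge> 0" using x by (auto simp: n_def dist_norm norm_minus_commute)
    have comp: "\<bar>x$1 - p$1\<bar> \<le> n" "\<bar>x$2 - p$2\<bar> \<le> n"
      using component_le_norm_cart[of "x - p"] by (auto simp: n_def)
    have "(w has_sum f x) UNIV"
      using a[of x] x t by (simp add: w_def t_def)
    moreover have "(w has_sum sum w low) low" by (rule has_sum_finite) (simp add: low_def)
    ultimately have "(w has_sum (f x - sum w low)) (UNIV - low)"
      by (rule has_sum_Diff) auto
    moreover have "sum w low = f p + L (x - p)"
      by (simp add: low_def w_def at_p L_def)
    ultimately have rest: "(w has_sum (f x - f p - L (x - p))) (UNIV - low)"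
      by (simp add: algebra_simps)
    have "(\<lambda>(i, j). t ^ (i + j) * \<bar>a i j\<bar>) summable_on (UNIV - low)"
      by (rule summable_on_subset_banach[OF abs]) auto
    then have "((\<lambda>(i, j). (n / t)\<^sup>2 * (t ^ (i + j) * \<bar>a i j\<bar>)) has_sum
        (n / t)\<^sup>2 * infsum (\<lambda>(i, j). t ^ (i + j) * \<bar>a i j\<bar>) (UNIV - low)) (UNIV - low)"
      using has_sum_cmult_right[OF has_sum_infsum] by (simp add: case_prod_unfold)
    with rest have "norm (f x - f p - L (x - p)) \<le>
        (n / t)\<^sup>2 * infsum (\<lambda>(i, j). t ^ (i + j) * \<bar>a i j\<bar>) (UNIV - low)"
    proof (rule norm_infsum_le)
      fix z assume "z \<in> UNIV - low"
      then obtain i j where z: "z = (i, j)" and ij: "i + j \<ge> 2"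
        by (cases z) (auto simp: low_def not_less_eq_eq numeral_2_eq_2 add_eq_if split: if_splits)
      have "\<bar>x$1 - p$1\<bar> ^ i * \<bar>x$2 - p$2\<bar> ^ j \<le> n ^ i * n ^ j"
        using comp n by (intro mult_mono power_mono) auto
      also have "\<dots> = (n / t) ^ (i + j) * t ^ (i + j)"
        using t by (simp add: power_add power_divide)
      also have "\<dots> \<le> (n / t)\<^sup>2 * t ^ (i + j)"
        using t n ij by (intro mult_right_mono power_decreasing) (auto simp: field_simps)
      finally have "\<bar>x$1 - p$1\<bar> ^ i * \<bar>x$2 - p$2\<bar> ^ j * \<bar>a i j\<bar> \<le> (n / t)\<^sup>2 * t ^ (i + j) * \<bar>a i j\<bar>"
        by (rule mult_right_mono) auto
      then show "norm (w z) \<le> (case z of (i, j) \<Rightarrow> (n / t)\<^sup>2 * (t ^ (i + j) * \<bar>a i j\<bar>))"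
        by (simp add: z w_def abs_mult power_abs mult.assoc)
    qed
    also have "\<dots> \<le> (n / t)\<^sup>2 * M"
    proof (rule mult_left_mono)
      show "infsum (\<lambda>(i, j). t ^ (i + j) * \<bar>a i j\<bar>) (UNIV - low) \<le> M"
        unfolding M_def using t
        by (intro infsum_mono2 abs summable_on_subset_banach[OF abs]) auto
    qed auto
    finally show ?thesis by (simp add: n_def power_divide mult.commute)
  qed
  moreover have "bounded_linear L"
    unfolding L_def
    by (intro bounded_linear_add bounded_linear_mult_left[THEN bounded_linear_compose]
        bounded_linear_vec_nth)
  ultimately have "(f has_derivative L) (at p)"
    using t by (intro has_derivative_of_quadratic_remainder)
  then show ?thesis by (auto simp: differentiable_def)
qed

text \<open>Inner products with fixed vectors are bounded linear and pass through the double series,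
  which reduces the claim to real-valued components.\<close>

lemma real_analytic_at_imp_differentiable:
  fixes f :: "real^2 \<Rightarrow> 'b::euclidean_space"
  assumes "real_analytic_at f p"
  shows "f differentiable (at p)"
proof -
  obtain a r where r: "r > 0" and a: "\<And>x. x \<in> ball p r \<Longrightarrow>
      ((\<lambda>(i, j). ((x$1 - p$1) ^ i * (x$2 - p$2) ^ j) *\<^sub>R a i j) has_sum f x) UNIV"
    using assms unfolding real_analytic_at_def by blast
  have "real_analytic_at (\<lambda>x. f x \<bullet> b) p" for b
    unfolding real_analytic_at_def
  proof (intro exI conjI ballI)
    fix x assume "x \<in> ball p r"
    from has_sum_bounded_linear[OF bounded_linear_inner_left a[OF this], of b]
    show "((\<lambda>(i, j). ((x$1 - p$1) ^ i * (x$2 - p$2) ^ j) *\<^sub>R (a i j \<bullet> b)) has_sum f x \<bullet> b) UNIV"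
      by (simp add: case_prod_unfold)
  qed (fact r)
  then show ?thesis
    by (subst differentiable_componentwise_within)
      (auto intro: real_analytic_at_imp_differentiable_real)
qed

section \<open>Angles and indices\<close>

lemma span_singleton_scaleR_eq:
  fixes v :: "'a::real_vector"
  assumes "c \<noteq> 0"
  shows "span {c *\<^sub>R v} = span {v}"
proof
  show "span {c *\<^sub>R v} \<subseteq> span {v}"
    by (intro span_minimal subspace_span) (auto intro: span_base span_scale)
  have "v = inverse c *\<^sub>R (c *\<^sub>R v)" using assms by simp
  then have "v \<in> span {c *\<^sub>R v}" by (metis span_base span_scale singletonI)
  then show "span {v} \<subseteq> span {c *\<^sub>R v}"
    by (intro span_minimal subspace_span) auto
qed

text \<open>The angle of a planar curve \<open>(x, y)\<close> differs from \<open>\<theta>\<close> by the arctangent of cross product over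
  inner product with the unit vector of angle \<open>\<theta>\<close>, as long as the inner product stays positive.\<close>

lemma angle_of_acute:
  fixes x y \<theta> :: real
  defines "D \<equiv> x * cos \<theta> + y * sin \<theta>" and "W \<equiv> y * cos \<theta> - x * sin \<theta>"
  assumes "D > 0"
  shows "span {vector [x, y] :: real^2} =
    span {vector [cos (\<theta> + arctan (W / D)), sin (\<theta> + arctan (W / D))]}"
proof -
  \<comment> \<open>Since \<open>D > 0\<close>, this is the square root of
    \<open>D\<^sup>2 + W\<^sup>2\<close>, that is, the Euclidean length of
    \<open>(x, y)\<close>.\<close>
  define \<rho> where "\<rho> = D * sqrt (1 + (W / D)\<^sup>2)"
  have \<rho>: "\<rho> \<noteq> 0" using assms(3) by (simp add: \<rho>_def add_nonneg_eq_0_iff)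
  have cs: "\<rho> * cos (arctan (W / D)) = D" "\<rho> * sin (arctan (W / D)) = W"
    using assms(3) by (auto simp: \<rho>_def cos_arctan sin_arctan add_nonneg_eq_0_iff)
  have "x = \<rho> * cos (\<theta> + arctan (W / D))"
  proof -
    have "\<rho> * cos (\<theta> + arctan (W / D)) = cos \<theta> * D - sin \<theta> * W"
      using cs by (simp add: cos_add right_diff_distrib mult.left_commute[of \<rho>])
    also have "\<dots> = x * ((sin \<theta>)\<^sup>2 + (cos \<theta>)\<^sup>2)"
      unfolding D_def W_def by algebra
    finally show ?thesis by simp
  qed
  moreover have "y = \<rho> * sin (\<theta> + arctan (W / D))"
  proof -
    have "\<rho> * sin (\<theta> + arctan (W / D)) = sin \<theta> * D + cos \<theta> * W"
      using cs by (simp add: sin_add distrib_left mult.left_commute[of \<rho>])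
    also have "\<dots> = y * ((sin \<theta>)\<^sup>2 + (cos \<theta>)\<^sup>2)"
      unfolding D_def W_def by algebra
    finally show ?thesis by simp
  qed
  ultimately have "vector [x, y] = \<rho> *\<^sub>R (vector [cos (\<theta> + arctan (W / D)), sin (\<theta> + arctan (W / D))] :: real^2)"
    by (simp add: vec_eq_iff forall_2)
  then show ?thesis using \<rho> by (simp add: span_singleton_scaleR_eq)
qed

text \<open>The arctangent correction is continuous because the inner product never vanishes, and it
  takes the same value at both ends because the curve closes up. The angle of the field therefore
  varies by as much as the comparison angle \<open>\<theta>\<close>. The direction does not depend
  on the radius, so one angle function serves all circles.\<close>

lemma has_index_if_acute:
  fixes \<theta> x y :: "real \<Rightarrow> real"
  assumes d: "\<And>r t. r > 0 \<Longrightarrow> d (p + r *\<^sub>R vector [cos t, sin t]) = span {vector [x t, y t] :: real^2}"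
    and cont: "continuous_on {0..2*pi} \<theta>" "continuous_on {0..2*pi} x" "continuous_on {0..2*pi} y"
    and acute: "\<And>t. t \<in> {0..2*pi} \<Longrightarrow> x t * cos (\<theta> t) + y t * sin (\<theta> t) > 0"
    and closed: "x (2*pi) = x 0" "y (2*pi) = y 0" "\<theta> (2*pi) - \<theta> 0 = 2 * pi * of_int k"
  shows "has_index d p (of_int k)"
proof -
  define W where "W t = y t * cos (\<theta> t) - x t * sin (\<theta> t)" for t
  define D where "D t = x t * cos (\<theta> t) + y t * sin (\<theta> t)" for t
  define \<theta>' where "\<theta>' t = \<theta> t + arctan (W t / D t)" for t
  have "continuous_on {0..2*pi} \<theta>'"
    unfolding \<theta>'_def W_def D_def using acute by (intro continuous_intros cont) force
  moreover have "span {vector [x t, y t] :: real^2} = span {vector [cos (\<theta>' t), sin (\<theta>' t)]}"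
    if "t \<in> {0..2*pi}" for t
    using angle_of_acute[OF acute[OF that]] by (simp add: \<theta>'_def W_def D_def)
  moreover have "of_int k = (\<theta>' (2*pi) - \<theta>' 0) / (2*pi)"
  proof -
    have e: "\<theta> (2*pi) = \<theta> 0 + of_int k * (2 * pi)" using closed(3) by (simp add: algebra_simps)
    have "cos (\<theta> (2*pi)) = cos (\<theta> 0)" "sin (\<theta> (2*pi)) = sin (\<theta> 0)"
      by (simp_all add: e cos_add sin_add mult.commute[of "of_int k"] sin_int_2pin cos_int_2pin)
    then have "W (2*pi) = W 0" "D (2*pi) = D 0" by (simp_all add: W_def D_def closed)
    then show ?thesis using closed(3) by (simp add: \<theta>'_def)
  qed
  ultimately show ?thesis
    unfolding has_index_def using d by (intro exI[of _ 1]) (auto intro!: exI[of _ \<theta>'])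
qed

section \<open>Indices of the two model direction fields\<close>

lemma odd_power_mult_self_nonneg:
  fixes x :: real
  assumes "odd k"
  shows "x ^ k * x \<ge> 0" "x \<noteq> 0 \<Longrightarrow> x ^ k * x > 0"
proof -
  have "x ^ k * x = x ^ (Suc k)" by simp
  moreover have "even (Suc k)" using assms by simp
  ultimately show "x ^ k * x \<ge> 0" "x \<noteq> 0 \<Longrightarrow> x ^ k * x > 0"
    by (auto simp del: power_Suc simp: zero_less_power_eq zero_le_even_power)
qed

text \<open>Both summands are even powers, and sine and cosine have no common zero. On the unit
  circle the sum is the inner product of \<open>(v^k, u^k)\<close> with \<open>(v, u)\<close>, so
  the two fields form an acute angle.\<close>

lemma sin_cos_odd_power_pos:
  assumes "odd k"
  shows "sin t ^ k * sin t + cos t ^ k * cos t > (0::real)"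
proof (cases "sin t = 0")
  case True
  then have "cos t \<noteq> 0" by (metis sin_zero_abs_cos_one abs_zero zero_neq_one)
  with True odd_power_mult_self_nonneg[OF assms] show ?thesis by simp
next
  case False
  with odd_power_mult_self_nonneg[OF assms] show ?thesis by (simp add: add_pos_nonneg)
qed

text \<open>The comparison field is \<open>(v, u)\<close>; at the point of angle \<open>t\<close> it
  has angle \<open>pi / 2 - t\<close>, which makes one negative turn.\<close>

lemma has_index_powers_minus_one:
  assumes "odd k"
  shows "has_index (\<lambda>p. span {vector [p$2 ^ k, p$1 ^ k] :: real^2}) 0 (-1)"
proof -
  have "has_index (\<lambda>p. span {vector [p$2 ^ k, p$1 ^ k] :: real^2}) 0 (of_int (-1))"
  proof (rule has_index_if_acute[where \<theta> = "\<lambda>t. pi / 2 - t" and x = "\<lambda>t. sin t ^ k" and y = "\<lambda>t. cos t ^ k"])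
    fix r t :: real assume "r > 0"
    have "vector [(r * sin t) ^ k, (r * cos t) ^ k] = r ^ k *\<^sub>R (vector [sin t ^ k, cos t ^ k] :: real^2)"
      by (simp add: vec_eq_iff forall_2 power_mult_distrib)
    with \<open>r > 0\<close> show "span {vector [(0 + r *\<^sub>R vector [cos t, sin t] :: real^2) $ 2 ^ k,
        (0 + r *\<^sub>R vector [cos t, sin t] :: real^2) $ 1 ^ k]} = span {vector [sin t ^ k, cos t ^ k] :: real^2}"
      by (simp add: span_singleton_scaleR_eq)
  next
    fix t :: real
    show "sin t ^ k * cos (pi / 2 - t) + cos t ^ k * sin (pi / 2 - t) > 0"
      using sin_cos_odd_power_pos[OF assms] by (simp add: sin_diff cos_diff)
  qed (auto intro!: continuous_intros)
  then show ?thesis by simp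
qed

text \<open>The comparison field is \<open>(v, - u)\<close>, of angle \<open>t - pi / 2\<close>,
  which makes one positive turn.\<close>

lemma has_index_powers_one:
  assumes "odd k"
  shows "has_index (\<lambda>p. span {vector [p$2 ^ k, - (p$1 ^ k)] :: real^2}) 0 1"
proof -
  have "has_index (\<lambda>p. span {vector [p$2 ^ k, - (p$1 ^ k)] :: real^2}) 0 (of_int 1)"
  proof (rule has_index_if_acute[where \<theta> = "\<lambda>t. t - pi / 2" and x = "\<lambda>t. sin t ^ k" and y = "\<lambda>t. - (cos t ^ k)"])
    fix r t :: real assume "r > 0"
    have "vector [(r * sin t) ^ k, - ((r * cos t) ^ k)] = r ^ k *\<^sub>R (vector [sin t ^ k, - (cos t ^ k)] :: real^2)"
      by (simp add: vec_eq_iff forall_2 power_mult_distrib)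
    with \<open>r > 0\<close> show "span {vector [(0 + r *\<^sub>R vector [cos t, sin t] :: real^2) $ 2 ^ k,
        - ((0 + r *\<^sub>R vector [cos t, sin t] :: real^2) $ 1 ^ k)]} = span {vector [sin t ^ k, - (cos t ^ k)] :: real^2}"
      by (simp add: span_singleton_scaleR_eq)
  next
    fix t :: real
    show "sin t ^ k * cos (t - pi / 2) + - (cos t ^ k) * sin (t - pi / 2) > 0"
      using sin_cos_odd_power_pos[OF assms] by (simp add: sin_diff cos_diff)
  qed (auto intro!: continuous_intros)
  then show ?thesis by simp
qed

section \<open>Metrics and shape operators in coordinates\<close>

lemma has_derivative_vector_3:
  assumes "(f has_derivative f') F" "(g has_derivative g') F" "(k has_derivative k') F"
  shows "((\<lambda>x. vector [f x, g x, k x] :: real^3) has_derivative (\<lambda>v. vector [f' v, g' v, k' v])) F"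
proof -
  have "((\<lambda>x. f x *\<^sub>R vector [1, 0, 0] + g x *\<^sub>R vector [0, 1, 0] + k x *\<^sub>R vector [0, 0, 1] :: real^3)
      has_derivative
      (\<lambda>v. f' v *\<^sub>R vector [1, 0, 0] + g' v *\<^sub>R vector [0, 1, 0] + k' v *\<^sub>R vector [0, 0, 1])) F"
    by (intro has_derivative_add has_derivative_scaleR_left assms)
  moreover have "(\<lambda>x. f x *\<^sub>R vector [1, 0, 0] + g x *\<^sub>R vector [0, 1, 0] + k x *\<^sub>R vector [0, 0, 1] :: real^3)
      = (\<lambda>x. vector [f x, g x, k x])"
    for f g k :: "'a \<Rightarrow> real"
    by (simp add: fun_eq_iff vec_eq_iff forall_3)
  ultimately show ?thesis by simp
qed

lemma has_derivative_vec_nth: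
  "((\<lambda>x :: real^'n. x $ i) has_derivative (\<lambda>v. v $ i)) F"
  by (rule bounded_linear_imp_has_derivative[OF bounded_linear_vec_nth])

lemma has_derivative_vec_nth_power:
  "((\<lambda>x :: real^'n. x $ i ^ m) has_derivative (\<lambda>v. real m * p $ i ^ (m - 1) * v $ i)) (at p)"
  by (rule has_derivative_eq_rhs[OF has_derivative_power[OF has_derivative_vec_nth]]) auto

lemma has_derivative_vec_nth_power_divide:
  "((\<lambda>x :: real^'n. x $ i ^ (m + 1) / real (m + 1)) has_derivative (\<lambda>v. p $ i ^ m * v $ i)) (at p)"
proof -
  have "((\<lambda>x :: real^'n. x $ i ^ (m + 1) * inverse (real (m + 1))) has_derivative
      (\<lambda>v. real (m + 1) * p $ i ^ (m + 1 - 1) * v $ i * inverse (real (m + 1)))) (at p)"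
    by (intro has_derivative_mult_left has_derivative_vec_nth_power)
  moreover have "(\<lambda>v :: real^'n. real (m + 1) * p $ i ^ (m + 1 - 1) * v $ i * inverse (real (m + 1))) =
      (\<lambda>v. p $ i ^ m * v $ i)"
    by (simp add: fun_eq_iff del: of_nat_add)
  ultimately show ?thesis by (simp only: divide_inverse)
qed

lemma partial_eqI:
  assumes "(f has_derivative f') (at p)"
  shows "partial i f p = f' (axis i 1)"
  using frechet_derivative_at[OF assms] by (simp add: partial_def)

text \<open>Christoffel symbols are computed only where the metric is nondegenerate; this allows a
  formula valid on an open set to be differentiated.\<close>

lemma partial_cong_open:
  assumes "open U" "p \<in> U" "\<And>q. q \<in> U \<Longrightarrow> f q = g q" "(g has_derivative g') (at p)"
  shows "partial i f p = g' (axis i 1)"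
proof -
  have "(f has_derivative g') (at p)"
    by (rule has_derivative_transform_within_open[OF assms(4,1,2)]) (simp add: assms(3))
  then show ?thesis by (rule partial_eqI)
qed

text \<open>\<open>matrix_inv\<close> is defined by choice, so its value follows from exhibiting one
  inverse and the uniqueness of inverses.\<close>

lemma matrix_inv_antidiagonal:
  fixes F :: real
  assumes "F \<noteq> 0"
  shows "matrix_inv (vector [vector [0, F], vector [F, 0]] :: real^2^2) =
    vector [vector [0, 1 / F], vector [1 / F, 0]]"
proof -
  let ?A = "vector [vector [0, F], vector [F, 0]] :: real^2^2"
  let ?B = "vector [vector [0, 1 / F], vector [1 / F, 0]] :: real^2^2"
  have AB: "?A ** ?B = mat 1" and BA: "?B ** ?A = mat 1"
    using assms by (simp_all add: vec_eq_iff forall_2 matrix_matrix_mult_def sum_2 mat_def)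
  then have "\<exists>B. ?A ** B = mat 1 \<and> B ** ?A = mat 1" by blast
  from someI_ex[OF this] have inv: "?A ** matrix_inv ?A = mat 1"
    unfolding matrix_inv_def by blast
  have "matrix_inv ?A = (?B ** ?A) ** matrix_inv ?A" by (simp only: BA matrix_mul_lid)
  also have "\<dots> = ?B ** (?A ** matrix_inv ?A)" by (simp only: matrix_mul_assoc)
  also have "\<dots> = ?B" by (simp only: inv matrix_mul_rid)
  finally show ?thesis .
qed

lemma partial_const: "partial i (\<lambda>_. c) p = 0"
  using partial_eqI[OF has_derivative_const] by simp

text \<open>For \<open>g = 2 F du dv\<close> this is the formula \<open>K = - (ln \<bar>F\<bar>)\<^sub>u\<^sub>v / F\<close>; the function \<open>G\<close> is \<open>(ln \<bar>F\<bar>)\<^sub>v\<close>.\<close>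

lemma gaussian_curvature_null_coordinates:
  fixes F :: "real^2 \<Rightarrow> real"
  assumes metric: "\<And>q. metric_matrix h q = vector [vector [0, F q], vector [F q, 0]]"
    and U: "open U" "p \<in> U" "\<And>q. q \<in> U \<Longrightarrow> F q \<noteq> 0"
    and G: "\<And>q. q \<in> U \<Longrightarrow> partial 2 F q / F q = G q"
    and G': "(G has_derivative G') (at p)"
  shows "gaussian_curvature h p = - G' (axis 1 1) / F p"
proof -
  have m: "metric_matrix h q $ 1 $ 1 = 0" "metric_matrix h q $ 1 $ 2 = F q"
    "metric_matrix h q $ 2 $ 1 = F q" "metric_matrix h q $ 2 $ 2 = 0" for q
    by (simp_all add: metric)
  \<comment> \<open>For mixed lower indices each bracket of metric derivatives already cancels.
    These symbols vanish on the whole plane, even at zeros of \<open>F\<close>, and can be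
    differentiated as constant functions.\<close>
  have c12: "christoffel h 2 1 2 = (\<lambda>_. 0)" "christoffel h 2 2 1 = (\<lambda>_. 0)"
    unfolding fun_eq_iff by (simp_all add: christoffel_def sum_2 m partial_const)
  have c1: "christoffel h 1 1 2 q = 0" "christoffel h 2 1 1 q = 0" if "q \<in> U" for q
    using U(3)[OF that]
    by (simp_all add: christoffel_def sum_2 metric matrix_inv_antidiagonal partial_const)
  have c22: "christoffel h 2 2 2 q = G q" if "q \<in> U" for q
    using U(3)[OF that] G[OF that]
    by (simp add: christoffel_def sum_2 metric matrix_inv_antidiagonal partial_const)
  have "partial 1 (christoffel h 2 2 2) p = G' (axis 1 1)"
    by (rule partial_cong_open[OF U(1,2) c22 G'])
  moreover have "partial 2 (christoffel h 2 1 2) p = 0"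
    unfolding c12 by (rule partial_const)
  ultimately have "riemann h 2 2 1 2 p = G' (axis 1 1)"
    using U(2) by (simp add: riemann_def sum_2 c12 c1)
  then show ?thesis
    using U(3)[OF U(2)] by (simp add: gaussian_curvature_def sum_2 metric det_2)
qed

lemma shape_operator_eqI:
  assumes "(h has_derivative h') (at p)" "inj h'" "(\<nu> has_derivative \<nu>') (at p)"
    and "linear A" "\<And>v. \<nu>' v = - h' (A v)"
  shows "shape_operator h \<nu> p = A"
  unfolding shape_operator_def
    frechet_derivative_at[OF assms(1), symmetric] frechet_derivative_at[OF assms(3), symmetric]
proof (rule the_equality)
  fix B assume "linear B \<and> (\<forall>v. \<nu>' v = - h' (B v))"
  with assms(5) have "h' (B v) = h' (A v)" for v by simp
  then show "B = A" using \<open>inj h'\<close> by (auto simp: fun_eq_iff inj_def)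
qed (use assms in simp)

section \<open>Time-like minimal surfaces\<close>

text \<open>The curves \<open>\<alpha>(u)\<close>, \<open>\<beta>(v)\<close> with velocities \<open>(2a, 1 - a\<^sup>2, 1 + a\<^sup>2)\<close> and \<open>(2b, b\<^sup>2 - 1, 1 + b\<^sup>2)\<close>,
  where \<open>a = u\<^sup>m\<close> and \<open>b = v\<^sup>m\<close>, are null; their sum is a time-like minimal surface.\<close>

definition null_tangent_u :: "real \<Rightarrow> real^3" where
  "null_tangent_u a = vector [2 * a, 1 - a\<^sup>2, 1 + a\<^sup>2]"

definition null_tangent_v :: "real \<Rightarrow> real^3" where
  "null_tangent_v b = vector [2 * b, b\<^sup>2 - 1, 1 + b\<^sup>2]"

text \<open>The coordinates are antiderivatives of the null tangents, vanishing at the origin. For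
  \<open>m > 0\<close> the tangent plane there is the set of vectors with first coordinate 0, so the
  first coordinate is the height over it. In the theorem \<open>m = 2 * k + 1\<close>.\<close>

definition minimal_surface :: "nat \<Rightarrow> real^2 \<Rightarrow> real^3" where
  "minimal_surface m p = vector
     [2 * (p$1 ^ (m + 1) / real (m + 1)) + 2 * (p$2 ^ (m + 1) / real (m + 1)),
      p$1 - p$1 ^ (2 * m + 1) / real (2 * m + 1) - (p$2 - p$2 ^ (2 * m + 1) / real (2 * m + 1)),
      p$1 + p$1 ^ (2 * m + 1) / real (2 * m + 1) + (p$2 + p$2 ^ (2 * m + 1) / real (2 * m + 1))]"

text \<open>The Euclidean cross product of the two null tangents, with its third coordinate negated
  to make it Lorentz-orthogonal to them, is \<open>2 * (1 - a * b)\<^sup>2\<close> times this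
  vector.\<close>

definition minimal_normal :: "nat \<Rightarrow> real^2 \<Rightarrow> real^3" where
  "minimal_normal m p =
     (let a = p$1 ^ m; b = p$2 ^ m
      in vector [(1 + a * b) / (1 - a * b), (b - a) / (1 - a * b), (a + b) / (1 - a * b)])"

lemma minimal_surface_has_derivative:
  "(minimal_surface m has_derivative
     (\<lambda>v. v$1 *\<^sub>R null_tangent_u (p$1 ^ m) + v$2 *\<^sub>R null_tangent_v (p$2 ^ m))) (at p)"
proof -
  have eq: "v$1 *\<^sub>R null_tangent_u (p$1 ^ m) + v$2 *\<^sub>R null_tangent_v (p$2 ^ m) =
      vector [2 * (p$1 ^ m * v$1) + 2 * (p$2 ^ m * v$2),
        v$1 - p$1 ^ (2 * m) * v$1 - (v$2 - p$2 ^ (2 * m) * v$2),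
        v$1 + p$1 ^ (2 * m) * v$1 + (v$2 + p$2 ^ (2 * m) * v$2)]" for v :: "real^2"
    unfolding power_even_eq
    by (simp add: vec_eq_iff forall_3 null_tangent_u_def null_tangent_v_def algebra_simps)
  show ?thesis
    unfolding minimal_surface_def[abs_def] eq
    by (intro has_derivative_vector_3 has_derivative_add has_derivative_diff
        has_derivative_mult_right has_derivative_vec_nth_power_divide has_derivative_vec_nth)
qed

text \<open>For fixed \<open>b\<close> the normal moves along a straight null line of the quadric
  \<open>lorentz x x = 1\<close>, with direction \<open>null_tangent_v b\<close>; for fixed
  \<open>a\<close> it moves along one with direction \<open>null_tangent_u a\<close>. The derivative
  of the normal thus swaps the two tangents, which makes the shape operator antidiagonal.\<close>

lemma minimal_normal_has_derivative:
  assumes "p$1 ^ m * p$2 ^ m \<noteq> 1"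
  shows "(minimal_normal m has_derivative
     (\<lambda>v. (real m * p$1 ^ (m - 1) * v$1 / (1 - p$1 ^ m * p$2 ^ m)\<^sup>2) *\<^sub>R null_tangent_v (p$2 ^ m) +
          (real m * p$2 ^ (m - 1) * v$2 / (1 - p$1 ^ m * p$2 ^ m)\<^sup>2) *\<^sub>R null_tangent_u (p$1 ^ m))) (at p)"
proof -
  define a b where "a = p$1 ^ m" and "b = p$2 ^ m"
  define a' b' where "a' v = real m * p$1 ^ (m - 1) * v$1" and "b' v = real m * p$2 ^ (m - 1) * v$2"
    for v :: "real^2"
  have ne: "1 - a * b \<noteq> 0" using assms by (simp add: a_def b_def)
  have da: "((\<lambda>x. x$1 ^ m) has_derivative a') (at p)" "((\<lambda>x. x$2 ^ m) has_derivative b') (at p)"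
    unfolding a'_def b'_def by (rule has_derivative_vec_nth_power)+
  have D: "((\<lambda>x. 1 - x$1 ^ m * x$2 ^ m) has_derivative (\<lambda>v. - (a * b' v + a' v * b))) (at p)"
    using has_derivative_diff[OF has_derivative_const has_derivative_mult[OF da]]
    by (simp add: a_def b_def)
  have N1: "((\<lambda>x. 1 + x$1 ^ m * x$2 ^ m) has_derivative (\<lambda>v. a * b' v + a' v * b)) (at p)"
    using has_derivative_add[OF has_derivative_const has_derivative_mult[OF da]]
    by (simp add: a_def b_def)
  note N2 = has_derivative_diff[OF da(2,1)] and N3 = has_derivative_add[OF da]
  \<comment> \<open>The right-hand side has the shape that the quotient rule produces in each
    coordinate.\<close>
  have eq: "(a' v / (1 - a * b)\<^sup>2) *\<^sub>R null_tangent_v b + (b' v / (1 - a * b)\<^sup>2) *\<^sub>R null_tangent_u a =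
     vector [((a * b' v + a' v * b) * (1 - a * b) - (1 + a * b) * - (a * b' v + a' v * b)) / ((1 - a * b) * (1 - a * b)),
       ((b' v - a' v) * (1 - a * b) - (b - a) * - (a * b' v + a' v * b)) / ((1 - a * b) * (1 - a * b)),
       ((a' v + b' v) * (1 - a * b) - (a + b) * - (a * b' v + a' v * b)) / ((1 - a * b) * (1 - a * b))]" for v
    by (simp add: vec_eq_iff forall_3 null_tangent_u_def null_tangent_v_def power2_eq_square
        add_divide_distrib[symmetric] algebra_simps)
  show ?thesis
    using has_derivative_vector_3[OF has_derivative_divide'[OF N1 D] has_derivative_divide'[OF N2 D]
        has_derivative_divide'[OF N3 D]] ne
    unfolding minimal_normal_def[abs_def] Let_def a_def[symmetric] b_def[symmetric]
      a'_def[symmetric] b'_def[symmetric] eq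
    by simp
qed

lemma lorentz_null_tangent:
  "lorentz (x *\<^sub>R null_tangent_u a + y *\<^sub>R null_tangent_v b) (z *\<^sub>R null_tangent_u a + w *\<^sub>R null_tangent_v b)
    = - 2 * (1 - a * b)\<^sup>2 * (x * w + y * z)"
  by (simp add: lorentz_def null_tangent_u_def null_tangent_v_def) algebra

lemma lorentz_minimal_normal:
  assumes "p$1 ^ m * p$2 ^ m \<noteq> 1"
  shows "lorentz (minimal_normal m p) (minimal_normal m p) = 1"
    and "lorentz (minimal_normal m p) (x *\<^sub>R null_tangent_u (p$1 ^ m) + y *\<^sub>R null_tangent_v (p$2 ^ m)) = 0"
proof -
  define a b where "a = p$1 ^ m" and "b = p$2 ^ m"
  have ne: "1 - a * b \<noteq> 0" using assms by (simp add: a_def b_def)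
  have n: "minimal_normal m p = (1 / (1 - a * b)) *\<^sub>R vector [1 + a * b, b - a, a + b]"
    by (simp add: minimal_normal_def a_def b_def Let_def vec_eq_iff forall_3)
  have hom: "lorentz (s *\<^sub>R v) w = s * lorentz v w" "lorentz v (s *\<^sub>R w) = s * lorentz v w" for s v w
    by (simp_all add: lorentz_def algebra_simps)
  have "lorentz (vector [1 + a * b, b - a, a + b]) (vector [1 + a * b, b - a, a + b]) = (1 - a * b)\<^sup>2"
    by (simp add: lorentz_def) algebra
  then show "lorentz (minimal_normal m p) (minimal_normal m p) = 1"
    using ne by (simp add: n hom power2_eq_square)
  have "lorentz (vector [1 + a * b, b - a, a + b]) (x *\<^sub>R null_tangent_u a + y *\<^sub>R null_tangent_v b) = 0"
    by (simp add: lorentz_def null_tangent_u_def null_tangent_v_def) algebra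
  then show "lorentz (minimal_normal m p) (x *\<^sub>R null_tangent_u (p$1 ^ m) + y *\<^sub>R null_tangent_v (p$2 ^ m)) = 0"
    by (simp add: n hom a_def b_def)
qed

section \<open>Metric, curvature, umbilics and principal directions of the surfaces\<close>

lemma minimal_surface_frechet:
  "frechet_derivative (minimal_surface m) (at p) =
     (\<lambda>v. v$1 *\<^sub>R null_tangent_u (p$1 ^ m) + v$2 *\<^sub>R null_tangent_v (p$2 ^ m))"
  using frechet_derivative_at[OF minimal_surface_has_derivative] by simp

lemma minimal_surface_induced_metric:
  "induced_metric (minimal_surface m) p v w =
     - 2 * (1 - p$1 ^ m * p$2 ^ m)\<^sup>2 * (v$1 * w$2 + v$2 * w$1)"
  unfolding induced_metric_def minimal_surface_frechet by (rule lorentz_null_tangent)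

lemma minimal_surface_metric_matrix:
  "metric_matrix (minimal_surface m) p =
     vector [vector [0, - 2 * (1 - p$1 ^ m * p$2 ^ m)\<^sup>2], vector [- 2 * (1 - p$1 ^ m * p$2 ^ m)\<^sup>2, 0]]"
  by (simp add: metric_matrix_def minimal_surface_induced_metric vec_eq_iff forall_2 axis_def)

text \<open>Nondegeneracy of the metric gives injectivity: vectors with equal images have equal
  products with both coordinate vectors.\<close>

lemma minimal_surface_inj:
  fixes p :: "real^2"
  assumes "p$1 ^ m * p$2 ^ m \<noteq> 1"
  shows "inj (\<lambda>v :: real^2. v$1 *\<^sub>R null_tangent_u (p$1 ^ m) + v$2 *\<^sub>R null_tangent_v (p$2 ^ m))"
proof (rule injI)
  fix v w :: "real^2"
  assume eq: "v$1 *\<^sub>R null_tangent_u (p$1 ^ m) + v$2 *\<^sub>R null_tangent_v (p$2 ^ m) =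
    w$1 *\<^sub>R null_tangent_u (p$1 ^ m) + w$2 *\<^sub>R null_tangent_v (p$2 ^ m)"
  have "induced_metric (minimal_surface m) p v x = induced_metric (minimal_surface m) p w x" for x
    by (simp add: induced_metric_def minimal_surface_frechet eq)
  from this[of "axis 1 1"] this[of "axis 2 1"] show "v = w"
    using assms by (simp add: minimal_surface_induced_metric axis_def vec_eq_iff forall_2)
qed

lemma lorentzian_form_minimal_surface:
  assumes "p$1 ^ m * p$2 ^ m \<noteq> 1"
  shows "lorentzian_form (induced_metric (minimal_surface m) p)"
proof -
  define F where "F = - 2 * (1 - p$1 ^ m * p$2 ^ m)\<^sup>2"
  have "F \<noteq> 0" using assms by (simp add: F_def)
  then show ?thesis
    unfolding lorentzian_form_def minimal_surface_induced_metric F_def[symmetric]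
    \<comment> \<open>The form is \<open>F\<close> times \<open>v$1 * w$2 + v$2 * w$1\<close>, so
      \<open>(1, y)\<close> has square \<open>2 * F * y\<close>, which is 1 or -1 for these
      choices.\<close>
    by (intro exI[of _ "vector [1, 1 / (2 * F)]"] exI[of _ "vector [1, - 1 / (2 * F)]"]) simp
qed

lemma gaussian_curvature_minimal_surface:
  assumes U: "open U" "p \<in> U" and ne: "\<And>q. q \<in> U \<Longrightarrow> q$1 ^ m * q$2 ^ m \<noteq> 1"
  shows "gaussian_curvature (minimal_surface m) p =
    - ((real m)\<^sup>2 * (p$1 * p$2) ^ (m - 1)) / (1 - p$1 ^ m * p$2 ^ m) ^ 4"
proof -
  define F where "F q = - 2 * (1 - q$1 ^ m * q$2 ^ m)\<^sup>2" for q :: "real^2"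
  define G where "G q = - 2 * q$1 ^ m * (real m * q$2 ^ (m - 1)) / (1 - q$1 ^ m * q$2 ^ m)" for q :: "real^2"
  define a b a' b' where "a = p$1 ^ m" and "b = p$2 ^ m" and "a' = real m * p$1 ^ (m - 1)"
    and "b' = real m * p$2 ^ (m - 1)"
  \<comment> \<open>The factor \<open>c\<close> drops out when \<open>G'\<close> is evaluated in the
    first coordinate direction.\<close>
  obtain c where c: "((\<lambda>q. q$2 ^ (m - 1)) has_derivative (\<lambda>v. c * v$2)) (at p)"
    using has_derivative_vec_nth_power by blast
  have D: "((\<lambda>x. 1 - x$1 ^ m * x$2 ^ m) has_derivative
      (\<lambda>v. - (q$1 ^ m * (real m * q$2 ^ (m - 1) * v$2) + real m * q$1 ^ (m - 1) * v$1 * q$2 ^ m))) (at q)"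
    for q :: "real^2"
    using has_derivative_diff[OF has_derivative_const
        has_derivative_mult[OF has_derivative_vec_nth_power has_derivative_vec_nth_power]]
    by simp
  define G' where "G' v =
      (((- 2 * a) * (real m * (c * v$2)) + (- 2 * (a' * v$1)) * b') * (1 - a * b) -
        - 2 * a * b' * - (a * (b' * v$2) + a' * v$1 * b)) / ((1 - a * b) * (1 - a * b))" for v :: "real^2"
  have "gaussian_curvature (minimal_surface m) p = - G' (axis 1 1) / F p"
  proof (rule gaussian_curvature_null_coordinates[OF _ U])
    show "metric_matrix (minimal_surface m) q = vector [vector [0, F q], vector [F q, 0]]" for q
      unfolding F_def by (rule minimal_surface_metric_matrix)
  next
    fix q assume q: "q \<in> U"
    show "F q \<noteq> 0" using ne[OF q] by (simp add: F_def)
    have "(F has_derivative (\<lambda>v. - 2 * (real 2 *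
        - (q$1 ^ m * (real m * q$2 ^ (m - 1) * v$2) + real m * q$1 ^ (m - 1) * v$1 * q$2 ^ m) *
        (1 - q$1 ^ m * q$2 ^ m) ^ (2 - 1)))) (at q)"
      unfolding F_def[abs_def] by (intro has_derivative_mult_right has_derivative_power D)
    then have "partial 2 F q = 4 * q$1 ^ m * (real m * q$2 ^ (m - 1)) * (1 - q$1 ^ m * q$2 ^ m)"
      by (simp add: partial_eqI axis_def)
    then show "partial 2 F q / F q = G q"
      using ne[OF q] by (simp add: F_def G_def power2_eq_square divide_simps)
  next
    have "1 - p$1 ^ m * p$2 ^ m \<noteq> 0" using ne[OF U(2)] by simp
    from has_derivative_divide'[OF has_derivative_mult[OF
          has_derivative_mult_right[OF has_derivative_vec_nth_power, of "- 2"]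
          has_derivative_mult_right[OF c, of "real m"]] D this]
    show "(G has_derivative G') (at p)"
      unfolding G_def[abs_def] G'_def[abs_def] a_def b_def a'_def b'_def .
  qed
  also have "G' (axis 1 1) = - 2 * a' * b' / (1 - a * b)\<^sup>2"
    unfolding G'_def power2_eq_square
    by (rule arg_cong2[where f = "(/)"]) (simp add: axis_def, algebra, rule refl)
  also have "F p = - 2 * (1 - a * b)\<^sup>2" by (simp add: F_def a_def b_def)
  also have "- (- 2 * a' * b' / (1 - a * b)\<^sup>2) / (- 2 * (1 - a * b)\<^sup>2) = - (a' * b') / (1 - a * b) ^ 4"
    by (simp add: power4_eq_xxxx power2_eq_square mult.assoc)
  also have "a' * b' = (real m)\<^sup>2 * (p$1 * p$2) ^ (m - 1)"
    by (simp add: a'_def b'_def power_mult_distrib power2_eq_square)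
  finally show ?thesis by (simp add: a_def b_def)
qed

lemma shape_operator_minimal_surface:
  assumes "p$1 ^ m * p$2 ^ m \<noteq> 1"
  shows "shape_operator (minimal_surface m) (minimal_normal m) p =
    (\<lambda>v. (- real m / (1 - p$1 ^ m * p$2 ^ m)\<^sup>2) *\<^sub>R vector [p$2 ^ (m - 1) * v$2, p$1 ^ (m - 1) * v$1])"
proof (rule shape_operator_eqI[OF minimal_surface_has_derivative minimal_surface_inj[OF assms]
      minimal_normal_has_derivative[OF assms]])
  show "linear (\<lambda>v :: real^2. (- real m / (1 - p$1 ^ m * p$2 ^ m)\<^sup>2) *\<^sub>R
      (vector [p$2 ^ (m - 1) * v$2, p$1 ^ (m - 1) * v$1] :: real^2))"
    by (rule linearI) (simp_all add: vec_eq_iff forall_2 algebra_simps add_divide_distrib)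
qed (simp add: mult.assoc)

text \<open>An antidiagonal operator is scalar only if it is zero, that is, if both
  \<open>p$1 ^ (m - 1)\<close> and \<open>p$2 ^ (m - 1)\<close> vanish; with \<open>m > 1\<close>
  this singles out the origin.\<close>

lemma umbilic_minimal_surface_iff:
  assumes "p$1 ^ m * p$2 ^ m \<noteq> 1" "m > 1"
  shows "umbilic (minimal_surface m) (minimal_normal m) p \<longleftrightarrow> p = 0"
proof
  assume "umbilic (minimal_surface m) (minimal_normal m) p"
  then obtain c where c: "shape_operator (minimal_surface m) (minimal_normal m) p v = c *\<^sub>R v" for v
    unfolding umbilic_def by blast
  from c[of "axis 1 1"] c[of "axis 2 1"] show "p = 0"
    using assms by (simp add: shape_operator_minimal_surface axis_def vec_eq_iff forall_2)
next
  assume "p = 0"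
  then show "umbilic (minimal_surface m) (minimal_normal m) p"
    using assms by (auto simp: umbilic_def shape_operator_minimal_surface vec_eq_iff forall_2
        power_0_left intro!: exI[of _ 0])
qed

text \<open>The entries of the shape operator are proportional to the squares of
  \<open>p$2 ^ k\<close> and \<open>p$1 ^ k\<close>, so eigenvectors have polynomial coordinates.
  The two signs of \<open>s\<close> give the two flows. They coincide on the coordinate axes, where
  the operator is nilpotent, but the vector stays nonzero there.\<close>

lemma principal_direction_minimal_surface:
  assumes "p$1 ^ (2 * k + 1) * p$2 ^ (2 * k + 1) \<noteq> 1" "p \<noteq> 0" "k > 0" "s\<^sup>2 = 1"
  shows "principal_direction (minimal_surface (2 * k + 1)) (minimal_normal (2 * k + 1)) p
    (span {vector [p$2 ^ k, s * p$1 ^ k]})"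
  unfolding principal_direction_def
proof (intro exI conjI)
  let ?v = "vector [p$2 ^ k, s * p$1 ^ k] :: real^2"
  let ?c = "- real (2 * k + 1) / (1 - p$1 ^ (2 * k + 1) * p$2 ^ (2 * k + 1))\<^sup>2 * (s * p$1 ^ k * p$2 ^ k)"
  have s: "s * (s * x) = x" for x
    using assms(4) by (simp add: power2_eq_square mult.assoc[symmetric])
  then have "s \<noteq> 0" using assms(4) by auto
  then show "?v \<noteq> 0" using assms(2,3) by (auto simp: vec_eq_iff forall_2)
  have "(vector [p$2 ^ (2 * k + 1 - 1) * ?v$2, p$1 ^ (2 * k + 1 - 1) * ?v$1] :: real^2) = (s * p$1 ^ k * p$2 ^ k) *\<^sub>R ?v"
    by (simp add: vec_eq_iff forall_2 s power_even_eq power2_eq_square) (use assms(4) in \<open>simp add: s mult_ac power2_eq_square\<close>)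
  then show "shape_operator (minimal_surface (2 * k + 1)) (minimal_normal (2 * k + 1)) p ?v = ?c *\<^sub>R ?v"
    unfolding shape_operator_minimal_surface[OF assms(1)] by simp
qed (rule refl)

lemma real_analytic_at_minimal_surface: "real_analytic_at (minimal_surface m) p"
proof -
  have "minimal_surface m = (\<lambda>x.
      (x$1 ^ (m + 1) *\<^sub>R vector [2 / real (m + 1), 0, 0] + x$2 ^ (m + 1) *\<^sub>R vector [2 / real (m + 1), 0, 0]) +
      (x$1 ^ 1 *\<^sub>R vector [0, 1, 1] + x$2 ^ 1 *\<^sub>R vector [0, - 1, 1]) +
      (x$1 ^ (2 * m + 1) *\<^sub>R vector [0, - 1 / real (2 * m + 1), 1 / real (2 * m + 1)] +
       x$2 ^ (2 * m + 1) *\<^sub>R vector [0, 1 / real (2 * m + 1), 1 / real (2 * m + 1)]))"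
    by (simp add: fun_eq_iff minimal_surface_def vec_eq_iff forall_3 mult.commute)
  then show ?thesis
    by (simp only:) (intro real_analytic_at_add real_analytic_at_monomial_1 real_analytic_at_monomial_2)
qed

lemma power_mult_neq_1_in_unit_ball:
  fixes p :: "real^2"
  assumes "p \<in> ball 0 1" "m > 0"
  shows "p$1 ^ m * p$2 ^ m \<noteq> 1"
proof -
  have "\<bar>p$i\<bar> < 1" for i using component_le_norm_cart[of p i] assms(1) by simp
  then have "\<bar>p$i ^ m\<bar> < 1" for i using assms(2) by (simp add: power_abs power_less_one_iff)
  then have "\<bar>p$1 ^ m\<bar> * \<bar>p$2 ^ m\<bar> < 1 * 1" by (intro mult_strict_mono') auto
  then show ?thesis by (auto simp: abs_mult[symmetric])
qed

lemma real_analytic_curvature_line_flow_minimal_surface: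
  assumes "odd k" "s\<^sup>2 = 1"
  shows "real_analytic_curvature_line_flow (ball 0 1 - {0}) (minimal_surface (2 * k + 1))
    (minimal_normal (2 * k + 1)) (\<lambda>p. span {vector [p$2 ^ k, s * p$1 ^ k]})"
  unfolding real_analytic_curvature_line_flow_def real_analytic_direction_field_def
proof (intro conjI ballI)
  have k: "k > 0" using assms(1) by (rule odd_pos)
  fix p :: "real^2" assume p: "p \<in> ball 0 1 - {0}"
  show "principal_direction (minimal_surface (2 * k + 1)) (minimal_normal (2 * k + 1)) p
      (span {vector [p$2 ^ k, s * p$1 ^ k]})"
    using p k assms(2) by (intro principal_direction_minimal_surface power_mult_neq_1_in_unit_ball) auto
  let ?X = "\<lambda>q :: real^2. vector [q$2 ^ k, s * q$1 ^ k] :: real^2"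
  have "?X = (\<lambda>q. q$2 ^ k *\<^sub>R vector [1, 0] + q$1 ^ k *\<^sub>R vector [0, s])"
    by (simp add: fun_eq_iff vec_eq_iff forall_2)
  then have "real_analytic_at ?X p"
    by (simp only:) (intro real_analytic_at_add real_analytic_at_monomial_1 real_analytic_at_monomial_2)
  moreover have "\<forall>\<^sub>F q in nhds p. q \<in> - {0}"
    using p by (intro eventually_nhds_in_open) auto
  then have "\<forall>\<^sub>F q in nhds p. ?X q \<noteq> 0 \<and> span {?X q} = span {?X q}"
    by (rule eventually_mono) (use k assms(2) in \<open>auto simp: vec_eq_iff forall_2\<close>)
  ultimately show "\<exists>X. real_analytic_at X p \<and>
      (\<forall>\<^sub>F q in nhds p. X q \<noteq> 0 \<and> span {vector [q$2 ^ k, s * q$1 ^ k] :: real^2} = span {X q})"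
    by (intro exI[of _ ?X]) (rule conjI)
qed

section \<open>Non-congruence\<close>

lemma pos_powers_not_eventually_le:
  fixes c C :: real
  assumes "c > 0" "N < M" "r > 0" and le: "\<And>s. 0 < s \<Longrightarrow> s < r \<Longrightarrow> c * s ^ N \<le> C * s ^ M"
  shows False
proof -
  \<comment> \<open>Half of \<open>r\<close> keeps \<open>s\<close> inside the range, the bound 1
    lowers the exponent \<open>M\<close> to \<open>Suc N\<close>, and the last bound forces
    \<open>(\<bar>C\<bar> + 1) * s \<le> c / 2\<close>.\<close>
  define s where "s = min (r / 2) (min 1 (c / (2 * (\<bar>C\<bar> + 1))))"
  have s: "0 < s" "s < r" "s \<le> 1" "s \<le> c / (2 * (\<bar>C\<bar> + 1))"
    using assms(1,3) by (auto simp: s_def)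
  have "c * s ^ N \<le> C * s ^ M" by (rule le[OF s(1,2)])
  also have "\<dots> \<le> (\<bar>C\<bar> + 1) * s ^ Suc N"
    using s assms(2) by (intro mult_mono power_decreasing) auto
  finally have "c \<le> (\<bar>C\<bar> + 1) * s" using s(1) by (simp add: mult.assoc[symmetric])
  moreover have "(\<bar>C\<bar> + 1) * s \<le> c / 2"
    using s(4) by (simp add: pos_le_divide_eq add_nonneg_pos mult_ac)
  ultimately show False using assms(1) by linarith
qed

text \<open>These sums are the heights of the surfaces up to a constant. The lower bound holds
  because one coordinate is at least half the norm in absolute value.\<close>

lemma even_powers_bounds:
  fixes q :: "real^2"
  assumes "even N"
  shows "q$1 ^ N + q$2 ^ N \<le> 2 * norm q ^ N" and "(norm q / 2) ^ N \<le> q$1 ^ N + q$2 ^ N"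
proof -
  have le: "q$i ^ N \<le> norm q ^ N" for i
    using power_mono[OF component_le_norm_cart[of q i], of N] assms by (simp add: power_even_abs)
  from le[of 1] le[of 2] show "q$1 ^ N + q$2 ^ N \<le> 2 * norm q ^ N" by linarith
  have "norm q \<le> \<bar>q$1\<bar> + \<bar>q$2\<bar>" using norm_le_l1_cart[of q] by (simp add: sum_2)
  then have "norm q / 2 \<le> \<bar>q$1\<bar> \<or> norm q / 2 \<le> \<bar>q$2\<bar>" by linarith
  then obtain i where "norm q / 2 \<le> \<bar>q$i\<bar>" by blast
  then have "(norm q / 2) ^ N \<le> q$i ^ N"
    using power_mono[of "norm q / 2" "\<bar>q$i\<bar>" N] assms by (simp add: power_even_abs)
  moreover have "q$j ^ N \<ge> 0" for j using assms by (rule zero_le_even_power)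
  moreover have "i = 1 \<or> i = 2" by (rule exhaust_2)
  ultimately show "(norm q / 2) ^ N \<le> q$1 ^ N + q$2 ^ N"
    by (metis add_increasing add_increasing2)
qed

text \<open>The image of the first basis vector is orthogonal to the image of the plane
  \<open>x$1 = 0\<close>, which contains that plane. Having square 1, it is the same basis vector up
  to sign, and pairing with it recovers the first coordinate.\<close>

lemma lorentz_isometry_preserves_normal_coordinate:
  assumes L: "linear L" "\<And>x y. lorentz (L x) (L y) = lorentz x y"
    and plane: "\<And>w. w$1 = 0 \<Longrightarrow> \<exists>z. z$1 = 0 \<and> L z = w"
  shows "\<bar>L x $ 1\<bar> = \<bar>x$1\<bar>"
proof -
  let ?e = "vector [1, 0, 0] :: real^3"
  have "lorentz (L ?e) w = 0" if w: "w$1 = 0" for w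
  proof -
    obtain z where z: "z$1 = 0" "L z = w" using plane[OF w] by blast
    have "lorentz (L ?e) (L z) = 0" unfolding L(2) using z(1) by (simp add: lorentz_def)
    then show ?thesis by (simp add: z(2))
  qed
  from this[of "vector [0, 1, 0]"] this[of "vector [0, 0, 1]"]
  have e: "L ?e $ 2 = 0" "L ?e $ 3 = 0" by (simp_all add: lorentz_def)
  have "lorentz (L ?e) (L ?e) = 1" unfolding L(2) by (simp add: lorentz_def)
  then have "\<bar>L ?e $ 1\<bar> = 1" by (simp add: lorentz_def e abs_square_eq_1 power2_eq_square[symmetric])
  moreover have "L ?e $ 1 * L x $ 1 = x$1"
    using L(2)[of ?e x] by (simp add: lorentz_def e)
  ultimately show ?thesis by (metis abs_mult mult_1)
qed

text \<open>Both surfaces have the same derivative \<open>D\<close> at the origin, with image the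
  common tangent plane. Differentiating the congruence there shows that the linear part
  \<open>L\<close> maps this plane onto itself, so heights agree up to sign. Invertibility of the
  derivative of \<open>\<phi>\<close> makes \<open>norm (\<phi> p)\<close> comparable to
  \<open>norm p\<close>.\<close>

lemma minimal_surface_congruent_height:
  assumes "congruent_germs (minimal_surface m) (minimal_surface n)" "m > 0" "n > 0"
  obtains \<phi> b B r where "b > 0" "B > 0" "r > 0"
    "\<And>p. norm p < r \<Longrightarrow> b * norm p \<le> norm (\<phi> p)"
    "\<And>p. norm p < r \<Longrightarrow> norm (\<phi> p) \<le> B * norm p"
    "\<And>p. norm p < r \<Longrightarrow> \<bar>minimal_surface n (\<phi> p) $ 1\<bar> = \<bar>minimal_surface m p $ 1\<bar>"
proof -
  obtain T \<phi> where T: "lorentz_isometry T" and \<phi>: "\<phi> 0 = 0" "real_analytic_at \<phi> 0"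
    "inj (frechet_derivative \<phi> (at 0))"
    and ev: "\<forall>\<^sub>F p in nhds 0. minimal_surface n (\<phi> p) = T (minimal_surface m p)"
    using assms(1) unfolding congruent_germs_def by blast
  obtain L a where L: "linear L" "\<And>x y. lorentz (L x) (L y) = lorentz x y" and Ta: "T = (\<lambda>x. L x + a)"
    using T unfolding lorentz_isometry_def by blast
  have s0: "minimal_surface k 0 = 0" for k by (simp add: minimal_surface_def vec_eq_iff forall_3)
  have "a = 0"
    using eventually_nhds_x_imp_x[OF ev] by (simp add: Ta s0 \<phi>(1) linear_0[OF L(1)])
  with ev have ev: "\<forall>\<^sub>F p in nhds 0. minimal_surface n (\<phi> p) = L (minimal_surface m p)"
    by (simp add: Ta)
  define D where "D v = v$1 *\<^sub>R null_tangent_u 0 + v$2 *\<^sub>R null_tangent_v 0" for v :: "real^2"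
  have ds: "(minimal_surface k has_derivative D) (at 0)" if "k > 0" for k
    using minimal_surface_has_derivative[of k 0] that by (simp add: D_def[abs_def] power_0_left)
  define J where "J = frechet_derivative \<phi> (at 0)"
  have d\<phi>: "(\<phi> has_derivative J) (at 0)"
    using real_analytic_at_imp_differentiable[OF \<phi>(2)] by (simp add: J_def frechet_derivative_works)
  have linJ: "linear J" by (rule has_derivative_linear[OF d\<phi>])
  have injJ: "inj J" using \<phi>(3) by (simp add: J_def)
  have "((\<lambda>p. minimal_surface n (\<phi> p)) has_derivative (\<lambda>v. D (J v))) (at 0)"
    using has_derivative_compose[OF d\<phi>, of "minimal_surface n" D] ds[OF assms(3)] by (simp add: \<phi>(1))
  moreover have "((\<lambda>p. L (minimal_surface m p)) has_derivative (\<lambda>v. L (D v))) (at 0)"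
    using has_derivative_compose[OF ds[OF assms(2)]
        linear_imp_has_derivative[OF L(1), of "at (minimal_surface m 0)"]] .
  then have "((\<lambda>p. minimal_surface n (\<phi> p)) has_derivative (\<lambda>v. L (D v))) (at 0)"
    by (rule has_derivative_transform_eventually)
      (use ev eventually_nhds_x_imp_x[OF ev] in \<open>auto simp: eventually_at_filter elim: eventually_mono\<close>)
  ultimately have DJ: "D (J v) = L (D v)" for v
    using has_derivative_unique by metis
  have "\<exists>z. z$1 = 0 \<and> L z = w" if "w$1 = 0" for w
  proof -
    \<comment> \<open>These coefficients solve \<open>D v = w\<close> in the tangent plane, where
      \<open>D v\<close> is \<open>(0, v$1 - v$2, v$1 + v$2)\<close>.\<close>
    have "D (vector [(w$2 + w$3) / 2, (w$3 - w$2) / 2]) = w"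
      using that by (simp add: D_def null_tangent_u_def null_tangent_v_def vec_eq_iff forall_3 field_simps)
    moreover obtain v where "J v = vector [(w$2 + w$3) / 2, (w$3 - w$2) / 2]"
      using linear_injective_imp_surjective[OF linJ injJ] by (metis surjD)
    ultimately have "L (D v) = w" by (simp add: DJ[symmetric])
    moreover have "D v $ 1 = 0" by (simp add: D_def null_tangent_u_def null_tangent_v_def)
    ultimately show ?thesis by blast
  qed
  note height = lorentz_isometry_preserves_normal_coordinate[OF L this]
  obtain b where b: "b > 0" "\<And>v. b * norm v \<le> norm (J v)"
    using linear_inj_bounded_below_pos[OF linJ injJ] by metis
  obtain B where B: "B > 0" "\<And>v. norm (J v) \<le> B * norm v"
    using linear_bounded_pos[OF linJ] by metis
  \<comment> \<open>An error of \<open>b / 2\<close> still leaves the lower bound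
    \<open>b / 2\<close> and raises the upper bound to \<open>B + b / 2\<close>.\<close>
  obtain d where d: "d > 0" "\<And>p. norm p < d \<Longrightarrow> norm (\<phi> p - J p) \<le> b / 2 * norm p"
    using d\<phi> b(1) unfolding has_derivative_at_alt by (auto simp: \<phi>(1) dest!: spec[of _ "b / 2"])
  obtain e where e: "e > 0" "\<And>p. norm p < e \<Longrightarrow> minimal_surface n (\<phi> p) = L (minimal_surface m p)"
    using ev by (auto simp: eventually_nhds_metric dist_norm)
  show ?thesis
  proof (rule that[of "b / 2" "B + b / 2" "min d e" \<phi>])
    fix p :: "real^2" assume p: "norm p < min d e"
    show "b / 2 * norm p \<le> norm (\<phi> p)"
      using d(2)[of p] b(2)[of p] p norm_triangle_ineq2[of "J p" "J p - \<phi> p"]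
      by (simp add: norm_minus_commute)
    show "norm (\<phi> p) \<le> (B + b / 2) * norm p"
      using d(2)[of p] B(2)[of p] p norm_triangle_ineq[of "J p" "\<phi> p - J p"]
      by (simp add: distrib_right)
    show "\<bar>minimal_surface n (\<phi> p) $ 1\<bar> = \<bar>minimal_surface m p $ 1\<bar>"
      using e(2)[of p] p by (simp add: height)
  qed (use b B d e in auto)
qed

text \<open>For odd exponents the height is a positive multiple of a sum of even powers, hence
  comparable to a power of the norm. Along the first axis a congruence would make
  \<open>s ^ (m + 1)\<close> and \<open>s ^ (n + 1)\<close> comparable for small \<open>s\<close>;
  whichever exponent is smaller, one of the two bounds in \<open>main\<close> fails.\<close>

lemma minimal_surface_not_congruent:
  assumes "odd m" "odd n" "m \<noteq> n"
  shows "\<not> congruent_germs (minimal_surface m) (minimal_surface n)"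
proof
  assume "congruent_germs (minimal_surface m) (minimal_surface n)"
  then obtain \<phi> b B r where br: "b > 0" "B > 0" "r > 0"
    and lo: "\<And>p. norm p < r \<Longrightarrow> b * norm p \<le> norm (\<phi> p)"
    and hi: "\<And>p. norm p < r \<Longrightarrow> norm (\<phi> p) \<le> B * norm p"
    and eq: "\<And>p. norm p < r \<Longrightarrow> \<bar>minimal_surface n (\<phi> p) $ 1\<bar> = \<bar>minimal_surface m p $ 1\<bar>"
    using minimal_surface_congruent_height assms odd_pos by metis
  have height: "\<bar>minimal_surface k q $ 1\<bar> = 2 / (k + 1) * (q$1 ^ (k + 1) + q$2 ^ (k + 1))" if "odd k" for k q
  proof -
    have "q$1 ^ (k + 1) + q$2 ^ (k + 1) \<ge> 0" using that by (intro add_nonneg_nonneg zero_le_even_power) auto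
    then have "2 / (k + 1) * (q$1 ^ (k + 1) + q$2 ^ (k + 1)) \<ge> 0" by (intro mult_nonneg_nonneg) auto
    then show ?thesis
      by (simp add: minimal_surface_def distrib_left add.commute del: power_Suc)
  qed
  have main: "2 / (n + 1) * (b / 2) ^ (n + 1) * s ^ (n + 1) \<le> 2 / (m + 1) * s ^ (m + 1)"
    "2 / (m + 1) * s ^ (m + 1) \<le> 2 / (n + 1) * 2 * B ^ (n + 1) * s ^ (n + 1)"
    if s: "0 < s" "s < r" for s
  proof -
    define p :: "real^2" where "p = vector [s, 0]"
    have "p = s *\<^sub>R axis 1 1" by (simp add: p_def vec_eq_iff forall_2 axis_def)
    then have np: "norm p = s" using s by simp
    have hp: "2 / (m + 1) * s ^ (m + 1) = 2 / (n + 1) * (\<phi> p $ 1 ^ (n + 1) + \<phi> p $ 2 ^ (n + 1))"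
      using eq[of p] s by (simp add: height assms np) (simp add: p_def add.commute)
    have "(b / 2) ^ (n + 1) * s ^ (n + 1) = (b * norm p / 2) ^ (n + 1)"
      by (simp add: np power_mult_distrib[symmetric] del: power_Suc)
    also have "\<dots> \<le> (norm (\<phi> p) / 2) ^ (n + 1)"
      using lo[of p] s br by (intro power_mono) (auto simp: np)
    also have "\<dots> \<le> \<phi> p $ 1 ^ (n + 1) + \<phi> p $ 2 ^ (n + 1)"
      by (rule even_powers_bounds) (use assms in simp)
    finally show "2 / (n + 1) * (b / 2) ^ (n + 1) * s ^ (n + 1) \<le> 2 / (m + 1) * s ^ (m + 1)"
      unfolding hp mult.assoc by (intro mult_left_mono) auto
    have "\<phi> p $ 1 ^ (n + 1) + \<phi> p $ 2 ^ (n + 1) \<le> 2 * norm (\<phi> p) ^ (n + 1)"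
      by (rule even_powers_bounds) (use assms in simp)
    also have "\<dots> \<le> 2 * (B * norm p) ^ (n + 1)"
      using hi[of p] s by (intro mult_left_mono power_mono) (auto simp: np)
    also have "\<dots> = 2 * (B ^ (n + 1) * s ^ (n + 1))"
      by (simp only: np power_mult_distrib)
    finally show "2 / (m + 1) * s ^ (m + 1) \<le> 2 / (n + 1) * 2 * B ^ (n + 1) * s ^ (n + 1)"
      unfolding hp mult.assoc by (intro mult_left_mono) auto
  qed
  show False
  proof (cases "m < n")
    case True
    show False
      by (rule pos_powers_not_eventually_le[OF _ _ br(3) main(2)]) (use True in auto)
  next
    case False
    show False
      by (rule pos_powers_not_eventually_le[OF _ _ br(3) main(1)]) (use False assms(3) br(1) in auto)
  qed
qed

theorem theoremF:
  "\<exists>(U :: nat \<Rightarrow> (real^2) set) (h :: nat \<Rightarrow> real^2 \<Rightarrow> real^3).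
     (\<forall>n. 0 \<in> U n \<and>
          real_analytic_timelike_surface (U n) (h n) \<and>
          (\<forall>p \<in> U n. gaussian_curvature (h n) p \<le> 0) \<and>
          (\<exists>\<nu>. unit_normal_field (U n) (h n) \<nu> \<and>
               isolated_umbilic (h n) \<nu> 0 \<and>
               (\<exists>d1 d2. real_analytic_curvature_line_flow (U n - {0}) (h n) \<nu> d1 \<and>
                        real_analytic_curvature_line_flow (U n - {0}) (h n) \<nu> d2 \<and>
                        has_index d1 0 1 \<and> has_index d2 0 (- 1)))) \<and>
     (\<forall>m n. m \<noteq> n \<longrightarrow> \<not> congruent_germs (h m) (h n))"
proof -
  \<comment> \<open>Odd \<open>k n\<close> gives the indices 1 and -1, and
    \<open>M n - 1 = 2 * k n\<close> is even, which makes the curvature non-positive. Distinct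
    \<open>n\<close> give distinct odd \<open>M n\<close>, as non-congruence requires.\<close>
  define k where "k n = 2 * n + 1" for n :: nat
  define M where "M n = 2 * k n + 1" for n
  have k: "odd (k n)" and M: "odd (M n)" "M n > 1" for n by (simp_all add: k_def M_def)
  \<comment> \<open>On the unit disc the product \<open>p$1 ^ M n * p$2 ^ M n\<close> stays below 1,
    so metric and normal are regular for every \<open>n\<close>.\<close>
  let ?B = "ball 0 1 :: (real^2) set"
  have ne: "p$1 ^ M n * p$2 ^ M n \<noteq> 1" if "p \<in> ?B" for p n
    using that M(2)[of n] by (intro power_mult_neq_1_in_unit_ball) auto
  have "real_analytic_timelike_surface ?B (minimal_surface (M n))" for n
    using ne unfolding real_analytic_timelike_surface_def real_analytic_on_def minimal_surface_frechet
    by (auto intro: real_analytic_at_minimal_surface minimal_surface_inj lorentzian_form_minimal_surface)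
  moreover have "gaussian_curvature (minimal_surface (M n)) p \<le> 0" if "p \<in> ?B" for p n
    by (subst gaussian_curvature_minimal_surface[OF open_ball that], erule ne)
      (intro divide_nonpos_nonneg, auto simp: M_def zero_le_mult_iff)
  moreover have "unit_normal_field ?B (minimal_surface (M n)) (minimal_normal (M n))" for n
    using ne unfolding unit_normal_field_def minimal_surface_frechet
    by (intro ballI conjI allI differentiableI[OF minimal_normal_has_derivative[OF ne]] lorentz_minimal_normal)
  moreover have "isolated_umbilic (minimal_surface (M n)) (minimal_normal (M n)) 0" for n
  proof -
    have "\<forall>\<^sub>F q in at 0. q \<in> ?B - {0}"
      by (intro eventually_at_in_open) auto
    moreover have "umbilic (minimal_surface (M n)) (minimal_normal (M n)) q \<longleftrightarrow> q = 0" if "q \<in> ?B" for q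
      using ne[OF that] M(2) by (rule umbilic_minimal_surface_iff)
    ultimately show ?thesis
      unfolding isolated_umbilic_def by (auto elim!: eventually_mono)
  qed
  moreover have "real_analytic_curvature_line_flow (?B - {0}) (minimal_surface (M n)) (minimal_normal (M n))
      (\<lambda>p. span {vector [p$2 ^ k n, - (p$1 ^ k n)]})" for n
    using real_analytic_curvature_line_flow_minimal_surface[OF k, of "- 1"] by (simp add: M_def)
  moreover have "real_analytic_curvature_line_flow (?B - {0}) (minimal_surface (M n)) (minimal_normal (M n))
      (\<lambda>p. span {vector [p$2 ^ k n, p$1 ^ k n]})" for n
    using real_analytic_curvature_line_flow_minimal_surface[OF k, of 1] by (simp add: M_def)
  moreover have "\<not> congruent_germs (minimal_surface (M i)) (minimal_surface (M j))" if "i \<noteq> j" for i j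
    using that M by (intro minimal_surface_not_congruent) (auto simp: M_def k_def)
  ultimately show ?thesis
    using has_index_powers_one[OF k] has_index_powers_minus_one[OF k]
    by (intro exI[of _ "\<lambda>_. ?B"] exI[of _ "\<lambda>n. minimal_surface (M n)"] conjI allI impI ballI
        exI[of _ "minimal_normal (M _)"] exI[of _ "\<lambda>p. span {vector [p$2 ^ k _, - (p$1 ^ k _)]}"]
        exI[of _ "\<lambda>p. span {vector [p$2 ^ k _, p$1 ^ k _]}"]) simp_all
qed

end
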